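(* A linear map $\varphi:(\mathbb{R}^{3}, g_{Sol})\longrightarrow(\mathbb{R}^{3},g_{Nil})$ from Sol space into Nil space with $$\varphi (X)=\begin{pmatrix} a_{11} & a_{12} & a_{13}\\ a_{21} & a_{22} & a_{23}\\ a_{31} & a_{32} & a_{33}\end{pmatrix}\begin{pmatrix}x\\ y\\ z\end{pmatrix},\qquad a_{ij}\in\mathbb{R},$$ is $\infty$-harmonic if and only if $\varphi$ takes one of the following forms (with arbitrary real entries $a_{ij}$ where indicated): $$\varphi (X)=\begin{pmatrix}0 & 0 & 0\\ a_{21} & a_{22} & 0\\ a_{31}&a_{32}&0\end{pmatrix}\begin{pmatrix}x\\ y\\ z\end{pmatrix},\qquad \varphi (X)=\begin{pmatrix}a_{11}& a_{12} & 0\\ 0 & 0 & 0\\ a_{31}&a_{32}&0\end{pmatrix}\begin{pmatrix}x\\ y\\ z\end{pmatrix},$$ $$\varphi (X)=\begin{pmatrix}0 &0 & 0\\ 0 & 0 &a_{23}\\ 0 &0&a_{33}\end{pmatrix}\begin{pmatrix}x\\ y\\ z\end{pmatrix},\quad\text{or}\quad \varphi (X)=\begin{pmatrix}0 &0 & a_{13}\\ 0 & 0 &0\\ 0 &0&a_{33}\end{pmatrix}\begin{pmatrix}x\\ y\\ z\end{pmatrix}.$$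
   Context: A smooth map $\varphi:(M,g)\to(N,h)$ between Riemannian manifolds is called $\infty$-harmonic if $\mathrm{d}\varphi(\mathrm{grad}\,|\mathrm{d}\varphi|^2)=0$ on $M$, where $|\mathrm{d}\varphi|^2=\mathrm{Trace}_g\,\varphi^*h$ is the energy density of $\varphi$ and $\mathrm{grad}$ is the gradient with respect to $g$. Nil space is $(\mathbb{R}^3,g_{Nil})$ and Sol space is $(\mathbb{R}^3,g_{Sol})$, where in the standard coordinates $(x,y,z)$ of $\mathbb{R}^3$: $g_{Nil}=\mathrm{d}x^2+\mathrm{d}y^2+(\mathrm{d}z-x\,\mathrm{d}y)^2$ and $g_{Sol}=e^{2z}\mathrm{d}x^2+e^{-2z}\mathrm{d}y^2+\mathrm{d}z^2$. A linear map means a map that is linear in these standard coordinates. *)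

theory Defs
  imports "HOL-Analysis.Analysis"
begin

text \<open>
  \<^term>\<open>Ck k f\<close>: \<^term>\<open>f\<close> is \<open>k\<close> times continuously differentiable on the whole space. For finite-dimensional
  domains this is the usual notion, since it suffices to control the derivatives in every
  fixed direction.
\<close>
primrec Ck :: "nat \<Rightarrow> ('a::euclidean_space \<Rightarrow> 'b::real_normed_vector) \<Rightarrow> bool" where
  "Ck 0 f \<longleftrightarrow> continuous_on UNIV f"
| "Ck (Suc k) f \<longleftrightarrow>
     f differentiable_on UNIV \<and> (\<forall>v. Ck k (\<lambda>p. frechet_derivative f (at p) v))"

definition smooth :: "('a::euclidean_space \<Rightarrow> 'b::real_normed_vector) \<Rightarrow> bool" where
  "smooth f \<longleftrightarrow> (\<forall>k. Ck k f)"

text \<open>A metric \<open>g\<close> on the manifold \<open>\<real>\<^sup>n\<close> assigns to every point \<open>p\<close> a bilinear form \<open>g p\<close> on the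
  tangent space at \<open>p\<close>, which is identified with \<open>\<real>\<^sup>n\<close> by the standard coordinates.\<close>
type_synonym 'n bilinear_field = "real ^ 'n \<Rightarrow> real ^ 'n \<Rightarrow> real ^ 'n \<Rightarrow> real"

definition riemannian_metric :: "('n::finite) bilinear_field \<Rightarrow> bool" where
  "riemannian_metric g \<longleftrightarrow>
     (\<forall>v w. smooth (\<lambda>p. g p v w)) \<and>
     (\<forall>p. bilinear (g p) \<and> (\<forall>v w. g p v w = g p w v) \<and> (\<forall>v. v \<noteq> 0 \<longrightarrow> 0 < g p v v))"

definition grad :: "('n::finite) bilinear_field \<Rightarrow> (real ^ 'n \<Rightarrow> real) \<Rightarrow> real ^ 'n \<Rightarrow> real ^ 'n" where
  "grad g f p = (THE w. \<forall>v. g p w v = frechet_derivative f (at p) v)"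

definition pullback ::
  "(real ^ 'm \<Rightarrow> real ^ 'n) \<Rightarrow> ('n::finite) bilinear_field \<Rightarrow> ('m::finite) bilinear_field" where
  "pullback \<phi> h p v w =
     h (\<phi> p) (frechet_derivative \<phi> (at p) v) (frechet_derivative \<phi> (at p) w)"

definition gram_matrix :: "(real ^ 'n \<Rightarrow> real ^ 'n \<Rightarrow> real) \<Rightarrow> real ^ 'n ^ ('n::finite)" where
  "gram_matrix b = (\<chi> i j. b (axis i 1) (axis j 1))"

text \<open>In coordinates, \<open>Trace\<^sub>g b = \<Sum>i j. g\<^sup>i\<^sup>j b\<^sub>i\<^sub>j\<close> with \<open>(g\<^sup>i\<^sup>j)\<close> the inverse of \<open>(g\<^sub>i\<^sub>j)\<close>; this is the
  trace of the endomorphism that \<open>g\<close> associates with the bilinear form \<open>b\<close>.\<close>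
definition metric_trace ::
  "('n::finite) bilinear_field \<Rightarrow> 'n bilinear_field \<Rightarrow> real ^ 'n \<Rightarrow> real" where
  "metric_trace g b p = trace (matrix_inv (gram_matrix (g p)) ** gram_matrix (b p))"

definition energy_density ::
  "('m::finite) bilinear_field \<Rightarrow> ('n::finite) bilinear_field \<Rightarrow> (real ^ 'm \<Rightarrow> real ^ 'n) \<Rightarrow>
     real ^ 'm \<Rightarrow> real" where
  "energy_density g h \<phi> = metric_trace g (pullback \<phi> h)"

definition infinity_harmonic ::
  "('m::finite) bilinear_field \<Rightarrow> ('n::finite) bilinear_field \<Rightarrow> (real ^ 'm \<Rightarrow> real ^ 'n) \<Rightarrow> bool" where
  "infinity_harmonic g h \<phi> \<longleftrightarrow>
     smooth \<phi> \<and> (\<forall>p. frechet_derivative \<phi> (at p) (grad g (energy_density g h \<phi>) p) = 0)"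

definition nil_metric :: "3 bilinear_field" where
  "nil_metric p v w =
     v $ 1 * w $ 1 + v $ 2 * w $ 2 + (v $ 3 - p $ 1 * v $ 2) * (w $ 3 - p $ 1 * w $ 2)"

definition sol_metric :: "3 bilinear_field" where
  "sol_metric p v w =
     exp (2 * p $ 3) * (v $ 1 * w $ 1) + exp (- 2 * p $ 3) * (v $ 2 * w $ 2) + v $ 3 * w $ 3"

lemma Ck_frechet:
  assumes "\<And>p. (f has_derivative f' p) (at p)" "\<And>v. Ck k (\<lambda>p. f' p v)"
  shows "Ck (Suc k) f"
proof -
  have "frechet_derivative f (at p) = f' p" for p
    using frechet_derivative_at[OF assms(1)[of p]] by simp
  then show ?thesis
    using assms by (auto simp: differentiable_on_def differentiable_def)
qed

lemma Ck_const: "Ck k (\<lambda>p. c)"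
  by (induction k arbitrary: c) (simp, rule Ck_frechet[where f' = "\<lambda>p v. 0"], auto)

lemma Ck_Suc_D: "Ck (Suc k) f \<Longrightarrow> (f has_derivative frechet_derivative f (at p)) (at p)"
  by (auto simp: differentiable_on_def frechet_derivative_works)

lemma Ck_Suc_imp: "Ck (Suc k) f \<Longrightarrow> Ck k f"
proof (induction k arbitrary: f)
  case 0 then show ?case by (simp add: differentiable_imp_continuous_on)
next
  case (Suc k)
  show ?case
    by (rule Ck_frechet[where f' = "\<lambda>p. frechet_derivative f (at p)"])
       (use Suc in \<open>auto simp: differentiable_on_def frechet_derivative_works\<close>)
qed

lemma Ck_add: "Ck k f \<Longrightarrow> Ck k g \<Longrightarrow> Ck k (\<lambda>p. f p + g p)"
proof (induction k arbitrary: f g)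
  case 0 then show ?case by (auto intro: continuous_intros)
next
  case (Suc k)
  note [derivative_intros] = Suc.prems[THEN Ck_Suc_D]
  show ?case
    by (rule Ck_frechet, (rule derivative_intros)+) (use Suc in auto)
qed

lemma Ck_mult:
  fixes f g :: "'a::euclidean_space \<Rightarrow> real"
  shows "Ck k f \<Longrightarrow> Ck k g \<Longrightarrow> Ck k (\<lambda>p. f p * g p)"
proof (induction k arbitrary: f g)
  case 0 then show ?case by (auto intro: continuous_intros)
next
  case (Suc k)
  note d = Suc.prems[THEN Ck_Suc_D]
  show ?case
    by (rule Ck_frechet, rule has_derivative_mult[OF d])
       (use Suc Suc.prems[THEN Ck_Suc_imp] in \<open>auto intro!: Ck_add\<close>)
qed

lemma Ck_linear: "bounded_linear f \<Longrightarrow> Ck k f"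
proof (cases k)
  case 0
  assume "bounded_linear f"
  then show ?thesis using 0 by (simp add: linear_continuous_on)
next
  case (Suc m)
  assume f: "bounded_linear f"
  then have "(f has_derivative f) (at p)" for p
    by (rule bounded_linear_imp_has_derivative)
  then show ?thesis
    unfolding Suc by (rule Ck_frechet[where f' = "\<lambda>p. f"]) (rule Ck_const)
qed

lemma Ck_nth: "Ck k (\<lambda>p::real^'n. p $ i)"
  by (rule Ck_linear) (rule bounded_linear_vec_nth)

lemma Ck_exp:
  fixes f :: "'a::euclidean_space \<Rightarrow> real"
  shows "Ck k f \<Longrightarrow> Ck k (\<lambda>p. exp (f p))"
proof (induction k arbitrary: f)
  case 0 then show ?case by (auto intro: continuous_intros)
next
  case (Suc k)
  note d = Suc.prems[THEN Ck_Suc_D]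
  show ?case
    by (rule Ck_frechet[where f' = "\<lambda>p v. exp (f p) * frechet_derivative f (at p) v"])
       (use Suc Ck_Suc_imp[OF Suc.prems] d in
         \<open>auto intro!: Ck_mult derivative_eq_intros simp: mult.commute\<close>)
qed

lemma Ck_diff: "Ck k f \<Longrightarrow> Ck k g \<Longrightarrow> Ck k (\<lambda>p. f p - (g p :: real))"
  using Ck_add[OF _ Ck_mult[OF Ck_const[of k "-1"]], of f g] by simp

lemma Ck_minus: "Ck k g \<Longrightarrow> Ck k (\<lambda>p. - (g p :: real))"
  using Ck_mult[OF Ck_const[of k "-1"]] by simp

lemma vec3_nz: "(v::real^3) \<noteq> 0 \<longleftrightarrow> v $ 1 \<noteq> 0 \<or> v $ 2 \<noteq> 0 \<or> v $ 3 \<noteq> 0"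
  by (simp add: vec_eq_iff forall_3)

lemma riemannian_nil: "riemannian_metric nil_metric"
proof -
  have "0 < nil_metric p v v" if "v \<noteq> 0" for p v
  proof -
    have "0 \<le> nil_metric p v v" by (simp add: nil_metric_def)
    moreover have "nil_metric p v v \<noteq> 0"
    proof
      assume "nil_metric p v v = 0"
      then have "(v $ 1)\<^sup>2 + (v $ 2)\<^sup>2 + (v $ 3 - p $ 1 * v $ 2)\<^sup>2 = 0"
        by (simp add: nil_metric_def power2_eq_square)
      then have "v $ 1 = 0 \<and> v $ 2 = 0 \<and> v $ 3 - p $ 1 * v $ 2 = 0"
        by (smt (verit) zero_le_power2 power2_less_eq_zero_iff)
      then show False using that by (auto simp: vec3_nz)
    qed
    ultimately show ?thesis by simp
  qed
  then show ?thesis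
    unfolding riemannian_metric_def smooth_def
    by (auto simp: bilinear_def linear_iff)
       (auto simp: nil_metric_def algebra_simps
         intro!: Ck_add Ck_mult Ck_diff Ck_const Ck_nth)
qed

lemma riemannian_sol: "riemannian_metric sol_metric"
proof -
  have "0 < sol_metric p v v" if "v \<noteq> 0" for p v
  proof -
    have "0 \<le> sol_metric p v v" by (simp add: sol_metric_def)
    moreover have "sol_metric p v v \<noteq> 0"
    proof
      assume "sol_metric p v v = 0"
      moreover have "0 \<le> exp (2 * p $ 3) * (v $ 1 * v $ 1)"
        "0 \<le> exp (- 2 * p $ 3) * (v $ 2 * v $ 2)" "0 \<le> v $ 3 * v $ 3" by simp_all
      ultimately have "exp (2 * p $ 3) * (v $ 1 * v $ 1) = 0 \<and>
          exp (- 2 * p $ 3) * (v $ 2 * v $ 2) = 0 \<and> v $ 3 * v $ 3 = 0"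
        unfolding sol_metric_def by linarith
      then show False using that by (auto simp: vec3_nz)
    qed
    ultimately show ?thesis by simp
  qed
  then show ?thesis
    unfolding riemannian_metric_def smooth_def
    by (auto simp: bilinear_def linear_iff)
       (auto simp: sol_metric_def algebra_simps
         intro!: Ck_add Ck_mult Ck_exp Ck_minus Ck_diff Ck_const Ck_nth)
qed

end

theory Submission
  imports Defs
begin

text \<open>
  For a linear map with matrix \<open>A\<close> the energy density depends only on the first coordinate \<open>u\<close> of the
  image point and on \<open>z\<close>: it is a quadratic polynomial in \<open>u\<close> whose coefficients are
  combinations of \<open>exp (- 2 * z)\<close>, \<open>exp (2 * z)\<close> and \<open>1\<close>. If \<open>A$1$1\<close> or \<open>A$1$2\<close> is nonzero,
  then \<open>u\<close> and \<open>z\<close> vary independently, and comparing coefficients of powers of \<open>u\<close> in the first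
  component of the equation forces the second row of \<open>A\<close> and then its third column to vanish.
  Otherwise \<open>u = A$1$3 * z\<close>; unless the third column vanishes, the energy density is then constant
  along the \<open>z\<close>-axis. As it is a sum of nonnegative terms, each of them is bounded, and the
  growth of the exponentials kills the first two columns, while boundedness of the term
  \<open>(A$3$3 - u * A$2$3)\<^sup>2\<close> gives \<open>A$1$3 * A$2$3 = 0\<close>.
\<close>

section \<open>Gradient and trace for the Sol metric\<close>

lemma grad_eqI:
  assumes "riemannian_metric g" "\<And>v. g p w v = frechet_derivative f (at p) v"
  shows "grad g f p = w"
  unfolding grad_def
proof (rule the_equality)
  fix w' assume w': "\<forall>v. g p w' v = frechet_derivative f (at p) v"
  have "bilinear (g p)" and pos: "\<And>v. v \<noteq> 0 \<Longrightarrow> 0 < g p v v"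
    using assms(1) by (auto simp: riemannian_metric_def)
  then have "g p (w' - w) (w' - w) = 0"
    using w' assms(2) by (simp add: bilinear_lsub)
  then show "w' = w"
    using pos[of "w' - w"] by fastforce
qed (use assms in simp)

lemma matrix_inv_unique:
  fixes A :: "'a::semiring_1 ^ 'n ^ 'n"
  assumes "A ** B = mat 1" "B ** A = mat 1"
  shows "matrix_inv A = B"
  unfolding matrix_inv_def
proof (rule some_equality)
  fix C assume "A ** C = mat 1 \<and> C ** A = mat 1"
  then show "C = B"
    using assms by (metis matrix_mul_assoc matrix_mul_lid matrix_mul_rid)
qed (use assms in simp)

lemma metric_trace_sol:
  "metric_trace sol_metric b p =
     exp (- 2 * p $ 3) * b p (axis 1 1) (axis 1 1) +
     exp (2 * p $ 3) * b p (axis 2 1) (axis 2 1) + b p (axis 3 1) (axis 3 1)"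
proof -
  define D :: "real ^ 3 ^ 3" where
    "D = (\<chi> i j. if i = j then vector [exp (- 2 * p $ 3), exp (2 * p $ 3), 1] $ i else 0)"
  have "matrix_inv (gram_matrix (sol_metric p)) = D"
    by (rule matrix_inv_unique)
       (auto simp: D_def gram_matrix_def sol_metric_def matrix_matrix_mult_def mat_def axis_def
         vec_eq_iff forall_3 sum_3 simp flip: exp_add)
  then show ?thesis
    by (simp add: metric_trace_def D_def gram_matrix_def trace_def matrix_matrix_mult_def sum_3)
qed

section \<open>Energy density of a linear map and the resulting equation\<close>

lemma frechet_derivative_matrix_vector_mult:
  "frechet_derivative ((*v) (A :: real ^ 'm ^ 'n)) (at p) = (*v) A"
  by (rule frechet_derivative_at[symmetric])
     (simp add: bounded_linear_imp_has_derivative)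

lemma smooth_matrix_vector_mult: "smooth ((*v) (A :: real ^ 'm ^ 'n))"
  by (simp add: smooth_def Ck_linear)

definition linear_energy :: "real ^ 3 ^ 3 \<Rightarrow> real \<Rightarrow> real \<Rightarrow> real" where
  "linear_energy A u z =
     exp (- 2 * z) * ((A$1$1)\<^sup>2 + (A$2$1)\<^sup>2 + (A$3$1 - u * A$2$1)\<^sup>2) +
     exp (2 * z) * ((A$1$2)\<^sup>2 + (A$2$2)\<^sup>2 + (A$3$2 - u * A$2$2)\<^sup>2) +
     ((A$1$3)\<^sup>2 + (A$2$3)\<^sup>2 + (A$3$3 - u * A$2$3)\<^sup>2)"

text \<open>The partial derivative of \<open>linear_energy A\<close> in \<open>u\<close>;
  \<open>energy_z\<close> is the one in \<open>z\<close>.\<close>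

definition energy_u :: "real ^ 3 ^ 3 \<Rightarrow> real \<Rightarrow> real \<Rightarrow> real" where
  "energy_u A u z =
     - 2 * (exp (- 2 * z) * A$2$1 * (A$3$1 - u * A$2$1) +
       exp (2 * z) * A$2$2 * (A$3$2 - u * A$2$2) + A$2$3 * (A$3$3 - u * A$2$3))"

definition energy_z :: "real ^ 3 ^ 3 \<Rightarrow> real \<Rightarrow> real \<Rightarrow> real" where
  "energy_z A u z =
     - 2 * exp (- 2 * z) * ((A$1$1)\<^sup>2 + (A$2$1)\<^sup>2 + (A$3$1 - u * A$2$1)\<^sup>2) +
     2 * exp (2 * z) * ((A$1$2)\<^sup>2 + (A$2$2)\<^sup>2 + (A$3$2 - u * A$2$2)\<^sup>2)"

lemma energy_density_linear:
  "energy_density sol_metric nil_metric ((*v) A) = (\<lambda>p. linear_energy A ((A *v p) $ 1) (p $ 3))"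
  by (rule ext)
     (simp add: energy_density_def metric_trace_sol pullback_def
       frechet_derivative_matrix_vector_mult nil_metric_def linear_energy_def
       matrix_vector_mult_basis column_def power2_eq_square)

lemma linear_energy_has_derivative:
  assumes "(u has_derivative u') (at p within S)" "(z has_derivative z') (at p within S)"
  shows "((\<lambda>p. linear_energy A (u p) (z p)) has_derivative
    (\<lambda>v. energy_u A (u p) (z p) * u' v + energy_z A (u p) (z p) * z' v)) (at p within S)"
  using assms unfolding linear_energy_def energy_u_def energy_z_def
  by (auto intro!: derivative_eq_intros simp: algebra_simps power2_eq_square fun_eq_iff)

text \<open>By the chain rule the differential is \<open>energy_u\<close> times row 1 of
  \<open>A\<close> plus \<open>energy_z\<close> times dz. The inverse Sol metric then scales its
  components by \<open>exp (- 2 * z)\<close>, \<open>exp (2 * z)\<close> and 1.\<close>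

lemma grad_energy_density_linear:
  fixes p :: "real ^ 3" and A :: "real ^ 3 ^ 3"
  defines "u \<equiv> (A *v p) $ 1" and "z \<equiv> p $ 3"
  shows "grad sol_metric (energy_density sol_metric nil_metric ((*v) A)) p =
    vector [exp (- 2 * z) * A$1$1 * energy_u A u z, exp (2 * z) * A$1$2 * energy_u A u z,
      A$1$3 * energy_u A u z + energy_z A u z]"
proof (rule grad_eqI[OF riemannian_sol])
  fix v
  have "((\<lambda>p. (A *v p) $ 1) has_derivative (\<lambda>v. (A *v v) $ 1)) (at p)"
    "((\<lambda>p. p $ 3) has_derivative (\<lambda>v. v $ 3)) (at p)"
    by (auto intro!: bounded_linear_imp_has_derivative bounded_linear_vec_nth
        bounded_linear_compose[OF bounded_linear_vec_nth])
  note * = frechet_derivative_at[OF linear_energy_has_derivative[OF this, of A]]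
  show "sol_metric p (vector [exp (- 2 * z) * A$1$1 * energy_u A u z,
      exp (2 * z) * A$1$2 * energy_u A u z, A$1$3 * energy_u A u z + energy_z A u z]) v =
    frechet_derivative (energy_density sol_metric nil_metric ((*v) A)) (at p) v"
    unfolding energy_density_linear u_def z_def
    by (subst fun_cong[OF *, symmetric])
      (simp add: sol_metric_def matrix_vector_mult_def sum_3 exp_minus field_simps)
qed

lemma infinity_harmonic_linear_iff:
  "infinity_harmonic sol_metric nil_metric ((*v) A) \<longleftrightarrow>
    (\<forall>p i. energy_u A ((A *v p) $ 1) (p $ 3) *
        (exp (- 2 * p $ 3) * A$1$1 * A$i$1 + exp (2 * p $ 3) * A$1$2 * A$i$2 + A$1$3 * A$i$3) +
      A$i$3 * energy_z A ((A *v p) $ 1) (p $ 3) = 0)"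
  unfolding infinity_harmonic_def grad_energy_density_linear frechet_derivative_matrix_vector_mult
  by (simp add: smooth_matrix_vector_mult vec_eq_iff[of _ 0] matrix_vector_mult_def[of A "vector _"] sum_3 algebra_simps)

section \<open>Vanishing criteria\<close>

lemma exp_balance_imp_zero:
  fixes a b :: real
  assumes "\<And>z. exp (- 2 * z) * a = exp (2 * z) * b"
  shows "a = 0" "b = 0"
proof -
  \<comment> \<open>At \<open>z = ln 2 / 2\<close> the two exponentials are 1/2 and 2.\<close>
  have "a = b" "a / 2 = 2 * b"
    using assms[of 0] assms[of "ln 2 / 2"] by (simp_all add: exp_minus field_simps)
  then show "a = 0" "b = 0" by auto
qed

lemma exp_mult_bounded_imp_zero:
  fixes k K :: real
  assumes "k \<ge> 0" "\<And>z. exp z * k \<le> K"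
  shows "k = 0"
proof (rule ccontr)
  assume "k \<noteq> 0"
  with assms(1) have "k > 0" by simp
  have "(K / k + 1) * k \<le> exp (K / k) * k"
    using exp_ge_add_one_self[of "K / k"] \<open>k > 0\<close>
    by (intro mult_right_mono) (auto simp: add.commute)
  also have "\<dots> \<le> K" by (rule assms)
  finally show False using \<open>k > 0\<close> by (simp add: distrib_right)
qed

lemma quadratic_zero_imp:
  fixes a b c :: real
  assumes "\<And>u. a + b * u + c * u\<^sup>2 = 0"
  shows "a = 0" "b = 0" "c = 0"
  using assms[of 0] assms[of 1] assms[of "-1"] by auto

section \<open>Classification by matrix entries\<close>

lemma linear_energy_const_imp:
  assumes const: "\<And>z. linear_energy A (k * z) z = linear_energy A 0 0"
  shows "A$1$1 = 0 \<and> A$2$1 = 0 \<and> A$3$1 = 0 \<and> A$1$2 = 0 \<and> A$2$2 = 0 \<and> A$3$2 = 0 \<and> k * A$2$3 = 0"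
proof -
  define K where "K = linear_energy A 0 0"
  define P where "P z = (A$1$1)\<^sup>2 + (A$2$1)\<^sup>2 + (A$3$1 - k * z * A$2$1)\<^sup>2" for z
  define Q where "Q z = (A$1$2)\<^sup>2 + (A$2$2)\<^sup>2 + (A$3$2 - k * z * A$2$2)\<^sup>2" for z
  define R where "R z = (A$1$3)\<^sup>2 + (A$2$3)\<^sup>2 + (A$3$3 - k * z * A$2$3)\<^sup>2" for z
  have sum: "exp (- 2 * z) * P z + exp (2 * z) * Q z + R z = K" for z
    using const[of z] by (simp add: linear_energy_def K_def P_def Q_def R_def)
  have nonneg: "P z \<ge> 0" "Q z \<ge> 0" "R z \<ge> 0" for z
    by (simp_all add: P_def Q_def R_def)
  have bounds: "exp (- 2 * z) * P z \<le> K" "exp (2 * z) * Q z \<le> K" "R z \<le> K" for z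
  proof -
    have "0 \<le> exp (- 2 * z) * P z" "0 \<le> exp (2 * z) * Q z"
      using nonneg by simp_all
    with sum[of z] nonneg(3)[of z]
    show "exp (- 2 * z) * P z \<le> K" "exp (2 * z) * Q z \<le> K" "R z \<le> K"
      by linarith+
  qed
  \<comment> \<open>Substituting \<open>- z / 2\<close> turns the factor
    \<open>exp (- 2 * z)\<close> into \<open>exp z\<close>.\<close>
  have P: "c = 0" if "0 \<le> c" "\<And>z. c \<le> P z" for c
  proof (rule exp_mult_bounded_imp_zero[OF that(1), of K])
    fix z
    have "exp z * c \<le> exp z * P (- z / 2)" using that(2) by (intro mult_left_mono) simp_all
    also have "\<dots> \<le> K" using bounds(1)[of "- z / 2"] by simp
    finally show "exp z * c \<le> K" .
  qed
  have Q: "c = 0" if "0 \<le> c" "\<And>z. c \<le> Q z" for c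
  proof (rule exp_mult_bounded_imp_zero[OF that(1), of K])
    fix z
    have "exp z * c \<le> exp z * Q (z / 2)" using that(2) by (intro mult_left_mono) simp_all
    also have "\<dots> \<le> K" using bounds(2)[of "z / 2"] by simp
    finally show "exp z * c \<le> K" .
  qed
  have 1: "(A$1$1)\<^sup>2 = 0" "(A$2$1)\<^sup>2 = 0" by (rule P; simp add: P_def)+
  have 2: "(A$1$2)\<^sup>2 = 0" "(A$2$2)\<^sup>2 = 0" by (rule Q; simp add: Q_def)+
  \<comment> \<open>With \<open>A$2$1 = 0\<close> the dependence on \<open>k * z\<close> drops out
    of \<open>P\<close>.\<close>
  have 3: "(A$3$1)\<^sup>2 = 0" by (rule P) (use 1 in \<open>simp_all add: P_def\<close>)
  have 4: "(A$3$2)\<^sup>2 = 0" by (rule Q) (use 2 in \<open>simp_all add: Q_def\<close>)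
  have "k * A$2$3 = 0"
  proof (rule ccontr)
    assume nz: "k * A$2$3 \<noteq> 0"
    \<comment> \<open>This \<open>z\<close> makes the last square in \<open>R z\<close> equal to
      \<open>(K + 1)\<^sup>2\<close>, which exceeds \<open>K\<close>.\<close>
    define z where "z = (A$3$3 - (K + 1)) / (k * A$2$3)"
    have "A$3$3 - k * z * A$2$3 = K + 1"
      using nz by (simp add: z_def field_simps)
    then have "(K + 1)\<^sup>2 \<le> K"
      using bounds(3)[of z] by (simp add: R_def) (smt (verit) zero_le_power2)
    moreover have "0 \<le> K" using nonneg(3)[of 0] bounds(3)[of 0] by linarith
    ultimately show False by (simp add: power2_eq_square algebra_simps) (smt (verit) zero_le_square)
  qed
  with 1 2 3 4 show ?thesis by simp
qed

text \<open>Each of the two outer disjuncts merges two of the four matrix forms.\<close>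

lemma infinity_harmonic_linear_iff_entries:
  "infinity_harmonic sol_metric nil_metric ((*v) A) \<longleftrightarrow>
    A$1$3 = 0 \<and> A$2$3 = 0 \<and> A$3$3 = 0 \<and>
      (A$1$1 = 0 \<and> A$1$2 = 0 \<or> A$2$1 = 0 \<and> A$2$2 = 0) \<or>
    A$1$1 = 0 \<and> A$2$1 = 0 \<and> A$3$1 = 0 \<and> A$1$2 = 0 \<and> A$2$2 = 0 \<and> A$3$2 = 0 \<and>
      A$1$3 * A$2$3 = 0" (is "?harmonic \<longleftrightarrow> ?entries")
proof
  assume ?entries
  \<comment> \<open>If the third column vanishes, either the bracket or \<open>energy_u\<close> is
    zero. If the first two vanish, so does \<open>energy_z\<close>, and \<open>energy_u\<close>
    carries a factor \<open>A$2$3\<close> that meets \<open>A$1$3\<close> from the bracket.\<close>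
  then show ?harmonic
    by (auto simp: infinity_harmonic_linear_iff forall_3 energy_u_def energy_z_def)
next
  assume ?harmonic
  have eq: "energy_u A ((A *v p) $ 1) (p $ 3) *
        (exp (- 2 * p $ 3) * A$1$1 * A$i$1 + exp (2 * p $ 3) * A$1$2 * A$i$2 + A$1$3 * A$i$3) +
      A$i$3 * energy_z A ((A *v p) $ 1) (p $ 3) = 0" for p i
    using \<open>?harmonic\<close> by (auto simp: infinity_harmonic_linear_iff)
  show ?entries
  proof (cases "A$1$1 = 0 \<and> A$1$2 = 0")
    case True
    have u: "(A *v vector [0, 0, z]) $ 1 = A$1$3 * z" for z
      by (simp add: matrix_vector_mult_def sum_3)
    have eq': "A$i$3 * (A$1$3 * energy_u A (A$1$3 * z) z + energy_z A (A$1$3 * z) z) = 0" for i z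
      using eq[of "vector [0, 0, z]" i] True unfolding u by (simp add: algebra_simps)
    show ?thesis
    proof (cases "A$1$3 = 0 \<and> A$2$3 = 0 \<and> A$3$3 = 0")
      case False
      then have zero: "A$1$3 * energy_u A (A$1$3 * z) z + energy_z A (A$1$3 * z) z = 0" for z
        using eq'[of 1 z] eq'[of 2 z] eq'[of 3 z] by auto
      \<comment> \<open>\<open>zero\<close> says that the energy has derivative 0 along the
        z-axis.\<close>
      have "((\<lambda>z. linear_energy A (A$1$3 * z) z) has_real_derivative 0) (at z)" for z
      proof -
        have "((\<lambda>z. linear_energy A (A$1$3 * z) z) has_derivative
            (\<lambda>v. energy_u A (A$1$3 * z) z * (A$1$3 * v) + energy_z A (A$1$3 * z) z * v)) (at z)"
          by (rule linear_energy_has_derivative) (auto intro!: derivative_eq_intros)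
        moreover have "energy_u A (A$1$3 * z) z * (A$1$3 * v) + energy_z A (A$1$3 * z) z * v =
            (A$1$3 * energy_u A (A$1$3 * z) z + energy_z A (A$1$3 * z) z) * v" for v
          by (simp add: algebra_simps)
        ultimately show ?thesis by (simp only: zero has_field_derivative_def mult_zero_left lambda_zero)
      qed
      then have "linear_energy A (A$1$3 * z) z = linear_energy A (A$1$3 * 0) 0" for z
        by (intro DERIV_isconst_all) auto
      then show ?thesis
        using linear_energy_const_imp[of A "A$1$3"] by simp
    qed (use True in simp)
  next
    case False
    have ex: "\<exists>p. (A *v p) $ 1 = u \<and> p $ 3 = z" for u z
    proof (cases "A$1$1 = 0")
      case True
      with False show ?thesis
        by (intro exI[of _ "vector [0, (u - A$1$3 * z) / A$1$2, z]"])
          (simp add: matrix_vector_mult_def sum_3)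
    next
      case False
      then show ?thesis
        by (intro exI[of _ "vector [(u - A$1$3 * z) / A$1$1, 0, z]"])
          (simp add: matrix_vector_mult_def sum_3)
    qed
    have eq': "energy_u A u z *
        (exp (- 2 * z) * A$1$1 * A$i$1 + exp (2 * z) * A$1$2 * A$i$2 + A$1$3 * A$i$3) +
      A$i$3 * energy_z A u z = 0" for u z i
      using ex[of u z] eq[of _ i] by blast
    \<comment> \<open>The squared Sol norm of the differential of \<open>u\<close>.\<close>
    define D where "D z = exp (- 2 * z) * (A$1$1)\<^sup>2 + exp (2 * z) * (A$1$2)\<^sup>2 + (A$1$3)\<^sup>2" for z
    have D: "D z \<noteq> 0" for z
      using False by (auto simp: D_def add_nonneg_eq_0_iff)
    have row1: "energy_u A u z * D z + A$1$3 * energy_z A u z = 0" for u z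
      using eq'[of u z 1] by (simp add: D_def power2_eq_square mult.assoc)
    have row2: "A$2$1 = 0 \<and> A$2$2 = 0 \<and> A$2$3 = 0"
      if "\<And>u z. energy_u A u z = 0"
    proof -
      \<comment> \<open>\<open>energy_u\<close> is affine in \<open>u\<close>; this is half its
        slope at \<open>z = 0\<close>.\<close>
      have "exp 0 * (A$2$1)\<^sup>2 + exp 0 * (A$2$2)\<^sup>2 + (A$2$3)\<^sup>2 = 0"
        using that[of 1 0] that[of 0 0] by (simp add: energy_u_def algebra_simps power2_eq_square)
      then show ?thesis by (simp add: add_nonneg_eq_0_iff)
    qed
    show ?thesis
    proof (cases "A$1$3 = 0")
      case True
      then have "energy_u A u z = 0" for u z using row1[of u z] D[of z] by simp
      note 2 = row2[OF this]
      \<comment> \<open>Otherwise row 3 gives \<open>energy_z = 0\<close>, and balancing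
        exponentials forces \<open>A$1$1 = A$1$2 = 0\<close>.\<close>
      have "A$3$3 = 0"
      proof (rule ccontr)
        assume "A$3$3 \<noteq> 0"
        then have "energy_z A 0 z = 0" for z
          using eq'[of 0 z 3] \<open>\<And>u z. energy_u A u z = 0\<close> by simp
        then have "exp (- 2 * z) * ((A$1$1)\<^sup>2 + (A$3$1)\<^sup>2) = exp (2 * z) * ((A$1$2)\<^sup>2 + (A$3$2)\<^sup>2)" for z
          using 2 by (simp add: energy_z_def)
        from exp_balance_imp_zero[OF this] False show False by (simp add: add_nonneg_eq_0_iff)
      qed
      with True 2 show ?thesis by simp
    next
      case nz: False
      \<comment> \<open>Half the coefficients of \<open>u\<^sup>2\<close> and \<open>u\<close> in
        \<open>row1\<close>, for fixed \<open>z\<close>.\<close>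
      have coeffs: "A$1$3 * (exp (2 * z) * (A$2$2)\<^sup>2 - exp (- 2 * z) * (A$2$1)\<^sup>2) = 0"
        "D z * (exp (- 2 * z) * (A$2$1)\<^sup>2 + exp (2 * z) * (A$2$2)\<^sup>2 + (A$2$3)\<^sup>2) +
          2 * A$1$3 * (exp (- 2 * z) * A$2$1 * A$3$1 - exp (2 * z) * A$2$2 * A$3$2) = 0"
        for z
      proof -
        let ?s = "exp (- 2 * z)" and ?t = "exp (2 * z)"
        have *: "(- (?s * A$2$1 * A$3$1 + ?t * A$2$2 * A$3$2 + A$2$3 * A$3$3) * D z +
            A$1$3 * (?t * ((A$1$2)\<^sup>2 + (A$2$2)\<^sup>2 + (A$3$2)\<^sup>2) - ?s * ((A$1$1)\<^sup>2 + (A$2$1)\<^sup>2 + (A$3$1)\<^sup>2))) +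
          (D z * (?s * (A$2$1)\<^sup>2 + ?t * (A$2$2)\<^sup>2 + (A$2$3)\<^sup>2) +
          2 * A$1$3 * (?s * A$2$1 * A$3$1 - ?t * A$2$2 * A$3$2)) * u +
          A$1$3 * (?t * (A$2$2)\<^sup>2 - ?s * (A$2$1)\<^sup>2) * u\<^sup>2 = 0" for u
          using row1[of u z]
          by (simp add: energy_u_def energy_z_def) (simp add: algebra_simps power2_eq_square)
        show "A$1$3 * (?t * (A$2$2)\<^sup>2 - ?s * (A$2$1)\<^sup>2) = 0"
          by (rule quadratic_zero_imp(3)[OF *])
        show "D z * (?s * (A$2$1)\<^sup>2 + ?t * (A$2$2)\<^sup>2 + (A$2$3)\<^sup>2) +
          2 * A$1$3 * (?s * A$2$1 * A$3$1 - ?t * A$2$2 * A$3$2) = 0"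
          by (rule quadratic_zero_imp(2)[OF *])
      qed
      have "exp (- 2 * z) * (A$2$1)\<^sup>2 = exp (2 * z) * (A$2$2)\<^sup>2" for z
        using coeffs(1)[of z] nz by simp
      from exp_balance_imp_zero[OF this] have 12: "A$2$1 = 0" "A$2$2 = 0" by simp_all
      \<comment> \<open>The linear coefficient has shrunk to
        \<open>D 0 * (A$2$3)\<^sup>2\<close>.\<close>
      with coeffs(2)[of 0] D[of 0] have "A$2$3 = 0" by simp
      with 12 have "energy_u A u z = 0" for u z by (simp add: energy_u_def)
      \<comment> \<open>From here the case is refuted: the balance again forces
        \<open>A$1$1 = A$1$2 = 0\<close>.\<close>
      then have "energy_z A 0 z = 0" for z using row1[of 0 z] nz by simp
      then have "exp (- 2 * z) * ((A$1$1)\<^sup>2 + (A$3$1)\<^sup>2) = exp (2 * z) * ((A$1$2)\<^sup>2 + (A$3$2)\<^sup>2)" for z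
        using 12 by (simp add: energy_z_def)
      from exp_balance_imp_zero[OF this] False show ?thesis by (simp add: add_nonneg_eq_0_iff)
    qed
  qed
qed

theorem theorem3p2:
  fixes a11 a12 a13 a21 a22 a23 a31 a32 a33 :: real
    and \<phi> :: "real ^ 3 \<Rightarrow> real ^ 3"
  assumes "\<phi> = (\<lambda>X. (vector [vector [a11, a12, a13],
                              vector [a21, a22, a23],
                              vector [a31, a32, a33]] :: real ^ 3 ^ 3) *v X)"
  shows "infinity_harmonic sol_metric nil_metric \<phi> \<longleftrightarrow>
    (\<exists>b21 b22 b31 b32. \<phi> = (\<lambda>X. (vector [vector [0, 0, 0],
                                         vector [b21, b22, 0],
                                         vector [b31, b32, 0]] :: real ^ 3 ^ 3) *v X)) \<or>
    (\<exists>b11 b12 b31 b32. \<phi> = (\<lambda>X. (vector [vector [b11, b12, 0],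
                                         vector [0, 0, 0],
                                         vector [b31, b32, 0]] :: real ^ 3 ^ 3) *v X)) \<or>
    (\<exists>b23 b33. \<phi> = (\<lambda>X. (vector [vector [0, 0, 0],
                                 vector [0, 0, b23],
                                 vector [0, 0, b33]] :: real ^ 3 ^ 3) *v X)) \<or>
    (\<exists>b13 b33. \<phi> = (\<lambda>X. (vector [vector [0, 0, b13],
                                 vector [0, 0, 0],
                                 vector [0, 0, b33]] :: real ^ 3 ^ 3) *v X))"
proof -
  \<comment> \<open>Equality of maps becomes equality of entries.\<close>
  have eq_iff: "(*v) M = (*v) N \<longleftrightarrow> M = N" for M N :: "real ^ 3 ^ 3"
    by (metis matrix_eq)
  show ?thesis
    unfolding assms infinity_harmonic_linear_iff_entries eq_iff
    by (auto simp: vec_eq_iff forall_3)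
qed

end
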